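(* Let $f\in\mathbb{R}^n$, $\lambda_1,\lambda_2>0$, $0<\omega_{\min}\le\omega_{\max}<1$, and let $\mathcal{W}_\Theta$ be a weight operator mapping $x\in\mathbb{R}^{3n}$ to a pair of diagonal matrices $(W_1(x),W_2(x))$ in $\mathbb{R}^{2n\times 2n}$ with $\omega_{\min}I\preceq W_i(x)\preceq\omega_{\max}I$, $i=1,2$. Let $L_{\mathcal{W}}$ be the Lipschitz constant of $\mathcal{W}_\Theta$ on the ball $\mathcal{B}=\{x\in\mathbb{R}^{3n}:\|x\|_2\le r\}$, i.e. $$\|\mathcal{W}_\Theta(x)-\mathcal{W}_\Theta(y)\|\le L_{\mathcal{W}}\|x-y\|_2\qquad\forall x,y\in\mathcal{B},$$ where $\|\mathcal{W}_\Theta(x)\|:=\|\omega(x)\|_\infty$ with $\omega(x)=[\,\mathrm{diag}(W_1(x)),\mathrm{diag}(W_2(x))\,]\in\mathbb{R}^{4n}$. Then the mapping $\mathcal{T}_\theta$ is $L_{\mathcal{T}}$-Lipschitz on $\mathcal{B}$, i.e. $$\|\mathcal{T}_\theta(x)-\mathcal{T}_\theta(y)\|_2\le L_{\mathcal{T}}\|x-y\|_2\qquad\forall x,y\in\mathcal{B},$$ with the explicit upper bound $$L_{\mathcal{T}}\le\frac{(\lambda_1\|G\|^2+\lambda_2\|R\|^2)\,L_{\mathcal{W}}\,\|S\|\,\|f\|_2}{\alpha^2}.$$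
   Context: Let $h,w\ge 2$ be integers and $n=hw$. For $m\ge 2$ let $B_m\in\mathbb{R}^{m\times m}$ be the matrix with $(B_m z)_i = z_{i+1}-z_i$ for $1\le i\le m-1$ and $(B_m z)_m = z_m-z_{m-1}$. Put $\nabla_x = I_h\otimes B_w$, $\nabla_y = B_h\otimes I_w$, and $\nabla = \begin{bmatrix}\nabla_x\\ \nabla_y\end{bmatrix}\in\mathbb{R}^{2n\times n}$. Define $S=[\,I_n\;\; -\nabla^\top\,]\in\mathbb{R}^{n\times 3n}$, $G=[\,\nabla\;\; 0_{2n\times 2n}\,]\in\mathbb{R}^{2n\times 3n}$, $R=[\,0_{2n\times n}\;\; I_{2n}\,]\in\mathbb{R}^{2n\times 3n}$, and $A(W_1,W_2)=S^\top S+\lambda_1G^\top W_1G+\lambda_2R^\top W_2R$, which is symmetric positive definite for admissible weights. The scalars $\lambda_1,\lambda_2$ and the data $f$ are fixed. The map $\mathcal{T}_\theta:\mathbb{R}^{3n}\to\mathbb{R}^{3n}$ freezes the weights at its argument and returns the minimizer of the resulting quadratic problem: $\mathcal{T}_\theta(x)$ is the unique minimizer over $u\in\mathbb{R}^{3n}$ of $\frac12\|Su-f\|_2^2+\frac{\lambda_1}{2}(Gu)^\top W_1(x)(Gu)+\frac{\lambda_2}{2}(Ru)^\top W_2(x)(Ru)$, equivalently $\mathcal{T}_\theta(x)=A(W_1(x),W_2(x))^{-1}S^\top f$. $\alpha:=\sigma_{\min}^2(\mathcal{M})>0$, where $\sigma_{\min}$ is the smallest singular value and $\mathcal{M}=\begin{bmatrix}S\\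 \sqrt{\lambda_1\omega_{\min}}\,G\\ \sqrt{\lambda_2\omega_{\min}}\,R\end{bmatrix}$. $\|S\|,\|G\|,\|R\|$ are spectral norms; $\preceq$ is the Loewner order; $r>0$ is the radius of the ball. *)

theory Defs
  imports Complex_Main "Jordan_Normal_Form.Char_Poly" "HOL-Library.Product_Plus"
begin

section \<open>Norms, singular values, Loewner order\<close>

definition l2_norm :: "real vec \<Rightarrow> real" where
  "l2_norm v = sqrt (v \<bullet> v)"

text \<open>Only meaningful for vectors of positive dimension.\<close>

definition linf_norm :: "real vec \<Rightarrow> real" where
  "linf_norm v = Max {\<bar>v $ i\<bar> | i. i < dim_vec v}"

definition l2_ball :: "nat \<Rightarrow> real \<Rightarrow> real vec set" where
  "l2_ball m r = {x \<in> carrier_vec m. l2_norm x \<le> r}"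

text \<open>The operator norm induced by the Euclidean norms.\<close>

definition spectral_norm :: "real mat \<Rightarrow> real" where
  "spectral_norm A = Sup {l2_norm (A *\<^sub>v v) | v. v \<in> carrier_vec (dim_col A) \<and> l2_norm v \<le> 1}"

text \<open>
  The square roots of the eigenvalues of the Gram matrix are exactly the singular values when
  the matrix has at least as many rows as columns, which is the only case used below.
\<close>

definition singular_values :: "real mat \<Rightarrow> real set" where
  "singular_values A = {sqrt \<mu> | \<mu>. eigenvalue (transpose_mat A * A) \<mu>}"

definition sigma_min :: "real mat \<Rightarrow> real" where
  "sigma_min A = Min (singular_values A)"

definition psd :: "real mat \<Rightarrow> bool" where
  "psd A \<longleftrightarrow> square_mat A \<and> transpose_mat A = A
     \<and> (\<forall>v \<in> carrier_vec (dim_row A). 0 \<le> v \<bullet> (A *\<^sub>v v))"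

text \<open>To be used for matrices of the same size only.\<close>

definition loewner_le :: "real mat \<Rightarrow> real mat \<Rightarrow> bool" where
  "loewner_le A B \<longleftrightarrow> psd (B - A)"


section \<open>Kronecker product and the discrete gradient\<close>

definition append_cols :: "real mat \<Rightarrow> real mat \<Rightarrow> real mat" where
  "append_cols A B = four_block_mat A B (0\<^sub>m 0 (dim_col A)) (0\<^sub>m 0 (dim_col B))"

definition kronecker :: "real mat \<Rightarrow> real mat \<Rightarrow> real mat" where
  "kronecker A B = mat (dim_row A * dim_row B) (dim_col A * dim_col B)
     (\<lambda>(i, j). A $$ (i div dim_row B, j div dim_col B) * B $$ (i mod dim_row B, j mod dim_col B))"

text \<open>
  Indices are 0-based: rows \<open>0, \<dots>, m - 2\<close> are forward differences, and the last row
  \<open>m - 1\<close> is the backward difference.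
\<close>

definition diff_mat :: "nat \<Rightarrow> real mat" where
  "diff_mat m = mat m m (\<lambda>(i, j).
     if i < m - 1
     then (if j = i + 1 then 1 else if j = i then - 1 else 0)
     else (if j = m - 1 then 1 else if j = m - 2 then - 1 else 0))"

lemma diff_mat_mult_vec:
  assumes m: "2 \<le> m" and z: "z \<in> carrier_vec m" and i: "i < m"
  shows "(diff_mat m *\<^sub>v z) $ i =
    (if i < m - 1 then z $ (i + 1) - z $ i else z $ (m - 1) - z $ (m - 2))"
proof -
  have two: "(\<Sum>j<m. (if j = a then 1 else if j = b then - 1 else 0) * z $ j) = z $ a - z $ b"
    if "a < m" "b < m" "a \<noteq> b" for a b
  proof -
    have "(\<Sum>j<m. (if j = a then 1 else if j = b then - 1 else 0) * z $ j)
        = (\<Sum>j<m. (if j = a then z $ j else 0) - (if j = b then z $ j else 0))"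
      using that by (intro sum.cong) auto
    also have "\<dots> = z $ a - z $ b"
      using that by (simp add: sum_subtractf)
    finally show ?thesis .
  qed
  have "(diff_mat m *\<^sub>v z) $ i = (\<Sum>j<m. diff_mat m $$ (i, j) * z $ j)"
    using z i by (simp add: diff_mat_def scalar_prod_def atLeast0LessThan)
  also have "\<dots> = (if i < m - 1 then z $ (i + 1) - z $ i else z $ (m - 1) - z $ (m - 2))"
  proof (cases "i < m - 1")
    case True
    have "(\<Sum>j<m. diff_mat m $$ (i, j) * z $ j)
        = (\<Sum>j<m. (if j = i + 1 then 1 else if j = i then - 1 else 0) * z $ j)"
      using True i by (intro sum.cong) (auto simp: diff_mat_def)
    with two[of "i + 1" i] True show ?thesis by simp
  next
    case False
    have "(\<Sum>j<m. diff_mat m $$ (i, j) * z $ j)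
        = (\<Sum>j<m. (if j = m - 1 then 1 else if j = m - 2 then - 1 else 0) * z $ j)"
      using False i by (intro sum.cong) (auto simp: diff_mat_def)
    with two[of "m - 1" "m - 2"] False m show ?thesis by simp
  qed
  finally show ?thesis .
qed

definition nabla_x :: "nat \<Rightarrow> nat \<Rightarrow> real mat" where
  "nabla_x h w = kronecker (1\<^sub>m h) (diff_mat w)"

definition nabla_y :: "nat \<Rightarrow> nat \<Rightarrow> real mat" where
  "nabla_y h w = kronecker (diff_mat h) (1\<^sub>m w)"

definition nabla :: "nat \<Rightarrow> nat \<Rightarrow> real mat" where
  "nabla h w = nabla_x h w @\<^sub>r nabla_y h w"

definition S_mat :: "nat \<Rightarrow> nat \<Rightarrow> real mat" where
  "S_mat h w = append_cols (1\<^sub>m (h * w)) (- transpose_mat (nabla h w))"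

definition G_mat :: "nat \<Rightarrow> nat \<Rightarrow> real mat" where
  "G_mat h w = append_cols (nabla h w) (0\<^sub>m (2 * (h * w)) (2 * (h * w)))"

definition R_mat :: "nat \<Rightarrow> nat \<Rightarrow> real mat" where
  "R_mat h w = append_cols (0\<^sub>m (2 * (h * w)) (h * w)) (1\<^sub>m (2 * (h * w)))"

lemma dims:
  "diff_mat m \<in> carrier_mat m m"
  "nabla h w \<in> carrier_mat (2 * (h * w)) (h * w)"
  "S_mat h w \<in> carrier_mat (h * w) (3 * (h * w))"
  "G_mat h w \<in> carrier_mat (2 * (h * w)) (3 * (h * w))"
  "R_mat h w \<in> carrier_mat (2 * (h * w)) (3 * (h * w))"
proof -
  show *: "diff_mat m \<in> carrier_mat m m" for m
    by (simp add: diff_mat_def)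
  have dr: "dim_row (diff_mat m) = m" "dim_col (diff_mat m) = m" for m
    using *[of m] by auto
  show n: "nabla h w \<in> carrier_mat (2 * (h * w)) (h * w)"
    by (auto simp: nabla_def nabla_x_def nabla_y_def append_rows_def kronecker_def dr)
  show "S_mat h w \<in> carrier_mat (h * w) (3 * (h * w))"
    "G_mat h w \<in> carrier_mat (2 * (h * w)) (3 * (h * w))"
    "R_mat h w \<in> carrier_mat (2 * (h * w)) (3 * (h * w))"
    using n by (auto simp: S_mat_def G_mat_def R_mat_def append_cols_def)
qed

definition M_mat :: "nat \<Rightarrow> nat \<Rightarrow> real \<Rightarrow> real \<Rightarrow> real \<Rightarrow> real mat" where
  "M_mat h w lam1 lam2 omin =
     S_mat h w @\<^sub>r (sqrt (lam1 * omin) \<cdot>\<^sub>m G_mat h w) @\<^sub>r (sqrt (lam2 * omin) \<cdot>\<^sub>m R_mat h w)"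

definition alpha :: "nat \<Rightarrow> nat \<Rightarrow> real \<Rightarrow> real \<Rightarrow> real \<Rightarrow> real" where
  "alpha h w lam1 lam2 omin = (sigma_min (M_mat h w lam1 lam2 omin))\<^sup>2"


section \<open>Weights and the solution map\<close>

definition admissible_weight :: "nat \<Rightarrow> real \<Rightarrow> real \<Rightarrow> real mat \<Rightarrow> bool" where
  "admissible_weight m omin omax W \<longleftrightarrow>
     W \<in> carrier_mat m m \<and> diagonal_mat W
     \<and> loewner_le (omin \<cdot>\<^sub>m 1\<^sub>m m) W \<and> loewner_le W (omax \<cdot>\<^sub>m 1\<^sub>m m)"

definition weight_norm :: "real mat \<times> real mat \<Rightarrow> real" where
  "weight_norm W = linf_norm (vec_of_list (diag_mat (fst W)) @\<^sub>v vec_of_list (diag_mat (snd W)))"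

definition objective ::
  "nat \<Rightarrow> nat \<Rightarrow> real \<Rightarrow> real \<Rightarrow> real vec \<Rightarrow> real mat \<times> real mat \<Rightarrow> real vec \<Rightarrow> real" where
  "objective h w lam1 lam2 f W u =
     1 / 2 * (l2_norm (S_mat h w *\<^sub>v u - f))\<^sup>2
     + lam1 / 2 * ((G_mat h w *\<^sub>v u) \<bullet> (fst W *\<^sub>v (G_mat h w *\<^sub>v u)))
     + lam2 / 2 * ((R_mat h w *\<^sub>v u) \<bullet> (snd W *\<^sub>v (R_mat h w *\<^sub>v u)))"

definition T_map ::
  "nat \<Rightarrow> nat \<Rightarrow> real \<Rightarrow> real \<Rightarrow> real vec \<Rightarrow> (real vec \<Rightarrow> real mat \<times> real mat)
     \<Rightarrow> real vec \<Rightarrow> real vec" where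
  "T_map h w lam1 lam2 f W x =
     (THE u. is_arg_min (objective h w lam1 lam2 f (W x)) (\<lambda>u. u \<in> carrier_vec (3 * (h * w))) u)"

end

theory Submission
  imports Defs
begin

text \<open>
  The minimizer \<open>u = \<T>(x)\<close> satisfies the weak equation \<open>E\<^sub>x(u, v) = f \<bullet> S v\<close> for all \<open>v\<close>, where \<open>E\<^sub>x\<close> is
  the bilinear form of \<open>A(W\<^sub>1(x), W\<^sub>2(x))\<close>. Since the weights dominate \<open>\<omega>\<^sub>m\<^sub>i\<^sub>n\<close>, the form dominates
  \<open>\<parallel>\<M> v\<parallel>\<^sup>2 \<ge> \<alpha> \<parallel>v\<parallel>\<^sup>2\<close>. Testing with \<open>v = u\<close> gives \<open>\<parallel>u\<parallel> \<le> \<parallel>S\<parallel> \<parallel>f\<parallel> / \<alpha>\<close>; testing the difference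
  of the equations at \<open>x\<close> and \<open>y\<close> with \<open>d = \<T>(x) - \<T>(y)\<close> bounds \<open>\<alpha> \<parallel>d\<parallel>\<^sup>2\<close> by the difference of the
  weights, paired with \<open>\<T>(y)\<close> and \<open>d\<close>.
\<close>

section \<open>Euclidean norm and positive semidefinite forms\<close>

lemma scalar_prod_self_nonneg: "0 \<le> (v :: real vec) \<bullet> v"
  by (auto simp: scalar_prod_def intro: sum_nonneg)

lemma scalar_prod_self_eq_0_iff:
  assumes "(v :: real vec) \<in> carrier_vec m"
  shows "v \<bullet> v = 0 \<longleftrightarrow> v = 0\<^sub>v m"
proof
  assume "v \<bullet> v = 0"
  then have "\<forall>i<m. v $ i = 0"
    using assms by (auto simp: scalar_prod_def sum_nonneg_eq_0_iff)
  then show "v = 0\<^sub>v m" using assms by auto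
qed auto

lemma l2_norm_nonneg [simp]: "0 \<le> l2_norm v"
  by (simp add: l2_norm_def scalar_prod_self_nonneg)

lemma l2_norm_power2: "(l2_norm v)\<^sup>2 = v \<bullet> v"
  by (simp add: l2_norm_def scalar_prod_self_nonneg)

lemma l2_norm_smult: "l2_norm (c \<cdot>\<^sub>v v) = \<bar>c\<bar> * l2_norm v"
proof -
  have "(c \<cdot>\<^sub>v v) \<bullet> (c \<cdot>\<^sub>v v) = c\<^sup>2 * (v \<bullet> v)"
    by (simp add: power2_eq_square)
  then show ?thesis by (simp add: l2_norm_def real_sqrt_mult)
qed

text \<open>For \<open>c > 0\<close> this is the value at the minimum point
  \<open>t = - b / c\<close>. For \<open>c = 0\<close> the expression is affine in \<open>t\<close>,
  and nonnegativity everywhere forces \<open>b = 0\<close>.\<close>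

lemma discriminant_le_of_nonneg:
  fixes a b c :: real
  assumes nonneg: "\<And>t. 0 \<le> a + 2 * t * b + t\<^sup>2 * c" and "0 \<le> c"
  shows "b\<^sup>2 \<le> a * c"
proof (cases "c = 0")
  case True
  have "b = 0"
  proof (rule ccontr)
    assume "b \<noteq> 0"
    \<comment> \<open>This \<open>t\<close> gives \<open>a + 2 * t * b\<close> the value -1.\<close>
    with nonneg[of "- (a + 1) / (2 * b)"] True show False by (simp add: field_simps)
  qed
  with True show ?thesis by simp
next
  case False
  with \<open>0 \<le> c\<close> have "0 < c" by simp
  have "0 \<le> a - b\<^sup>2 / c"
    using nonneg[of "- b / c"] \<open>0 < c\<close> by (simp add: field_simps power2_eq_square)
  with \<open>0 < c\<close> show ?thesis by (simp add: field_simps)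
qed

lemma symmetric_scalar_prod:
  assumes "(B :: real mat) \<in> carrier_mat m m" "transpose_mat B = B"
    and "x \<in> carrier_vec m" "y \<in> carrier_vec m"
  shows "x \<bullet> (B *\<^sub>v y) = y \<bullet> (B *\<^sub>v x)"
proof -
  have "x \<bullet> (B *\<^sub>v y) = (B *\<^sub>v y) \<bullet> x"
    using assms by (intro comm_scalar_prod[of _ m]) auto
  also have "\<dots> = y \<bullet> (B *\<^sub>v x)"
    using transpose_vec_mult_scalar[of B m m x y] assms by simp
  finally show ?thesis .
qed

lemma quadratic_form_add_smult:
  assumes B: "(B :: real mat) \<in> carrier_mat m m" "transpose_mat B = B"
    and xy: "x \<in> carrier_vec m" "y \<in> carrier_vec m"
  shows "(x + t \<cdot>\<^sub>v y) \<bullet> (B *\<^sub>v (x + t \<cdot>\<^sub>v y))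
    = x \<bullet> (B *\<^sub>v x) + 2 * t * (x \<bullet> (B *\<^sub>v y)) + t\<^sup>2 * (y \<bullet> (B *\<^sub>v y))"
proof -
  have c: "B *\<^sub>v x \<in> carrier_vec m" "B *\<^sub>v y \<in> carrier_vec m" using B xy by auto
  have "B *\<^sub>v (x + t \<cdot>\<^sub>v y) = B *\<^sub>v x + t \<cdot>\<^sub>v (B *\<^sub>v y)"
    using B xy by (simp add: mult_add_distrib_mat_vec mult_mat_vec)
  then have "(x + t \<cdot>\<^sub>v y) \<bullet> (B *\<^sub>v (x + t \<cdot>\<^sub>v y))
      = (x \<bullet> (B *\<^sub>v x) + t * (x \<bullet> (B *\<^sub>v y))) + t * (y \<bullet> (B *\<^sub>v x) + t * (y \<bullet> (B *\<^sub>v y)))"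
    using c xy
    by (simp add: add_scalar_prod_distrib[of _ m] scalar_prod_add_distrib[of _ m] distrib_left)
  then show ?thesis
    using symmetric_scalar_prod[OF B xy] by (simp add: algebra_simps power2_eq_square)
qed

text \<open>The form is nonnegative on the whole line \<open>x + t y\<close>, so the discriminant
  bound applies. Semidefiniteness suffices, which allows both the identity matrix and a matrix
  shifted by its smallest eigenvalue.\<close>

lemma psd_Cauchy_Schwarz:
  assumes psd: "psd B" and B: "B \<in> carrier_mat m m"
    and xy: "x \<in> carrier_vec m" "y \<in> carrier_vec m"
  shows "(x \<bullet> (B *\<^sub>v y))\<^sup>2 \<le> (x \<bullet> (B *\<^sub>v x)) * (y \<bullet> (B *\<^sub>v y))"
proof (rule discriminant_le_of_nonneg)
  have sym: "transpose_mat B = B"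
    and nonneg: "\<And>v. v \<in> carrier_vec m \<Longrightarrow> 0 \<le> v \<bullet> (B *\<^sub>v v)"
    using psd B by (auto simp: psd_def)
  show "0 \<le> y \<bullet> (B *\<^sub>v y)" using nonneg xy by simp
  fix t
  show "0 \<le> x \<bullet> (B *\<^sub>v x) + 2 * t * (x \<bullet> (B *\<^sub>v y)) + t\<^sup>2 * (y \<bullet> (B *\<^sub>v y))"
    using nonneg[of "x + t \<cdot>\<^sub>v y"] xy quadratic_form_add_smult[OF B sym xy] by simp
qed

lemma Cauchy_Schwarz_l2_norm:
  assumes "x \<in> carrier_vec m" "y \<in> carrier_vec m"
  shows "\<bar>x \<bullet> y\<bar> \<le> l2_norm x * l2_norm y"
proof -
  have "psd (1\<^sub>m m)"
    by (auto simp: psd_def scalar_prod_self_nonneg)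
  from psd_Cauchy_Schwarz[OF this _ assms] have "(x \<bullet> y)\<^sup>2 \<le> (x \<bullet> x) * (y \<bullet> y)"
    using assms by simp
  then have "\<bar>x \<bullet> y\<bar>\<^sup>2 \<le> (l2_norm x * l2_norm y)\<^sup>2"
    by (simp add: power_mult_distrib l2_norm_power2)
  then show ?thesis by (rule power2_le_imp_le) simp
qed

section \<open>The spectral norm\<close>

text \<open>Cauchy-Schwarz in each row gives the Frobenius norm as a constant. Any finite constant
  will do: it makes the supremum in \<open>spectral_norm\<close> meaningful and later bounds an
  inverse matrix.\<close>

lemma mult_mat_vec_bounded:
  assumes A: "A \<in> carrier_mat p m"
  shows "\<exists>K>0. \<forall>v\<in>carrier_vec m. l2_norm (A *\<^sub>v v) \<le> K * l2_norm v"
proof -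
  define C where "C = (\<Sum>i<p. (l2_norm (row A i))\<^sup>2)"
  have C: "0 \<le> C" by (simp add: C_def sum_nonneg)
  \<comment> \<open>The summand 1 keeps the constant positive even for a zero matrix, so that
    \<open>1 / K\<close> can be used later.\<close>
  have "l2_norm (A *\<^sub>v v) \<le> (sqrt C + 1) * l2_norm v" if v: "v \<in> carrier_vec m" for v
  proof -
    have "(l2_norm (A *\<^sub>v v))\<^sup>2 = (\<Sum>i<p. (row A i \<bullet> v)\<^sup>2)"
      using A unfolding l2_norm_power2
      by (simp add: scalar_prod_def[of "A *\<^sub>v v"] power2_eq_square atLeast0LessThan)
    also have "\<dots> \<le> (\<Sum>i<p. (l2_norm (row A i))\<^sup>2 * (l2_norm v)\<^sup>2)"
    proof (rule sum_mono)
      fix i assume "i \<in> {..<p}"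
      then have "\<bar>row A i \<bullet> v\<bar> \<le> l2_norm (row A i) * l2_norm v"
        using A v by (intro Cauchy_Schwarz_l2_norm[of _ m]) auto
      then have "\<bar>row A i \<bullet> v\<bar>\<^sup>2 \<le> (l2_norm (row A i) * l2_norm v)\<^sup>2"
        by (rule power_mono) simp
      then show "(row A i \<bullet> v)\<^sup>2 \<le> (l2_norm (row A i))\<^sup>2 * (l2_norm v)\<^sup>2"
        by (simp add: power_mult_distrib)
    qed
    also have "\<dots> = (sqrt C * l2_norm v)\<^sup>2"
      using C by (simp add: C_def sum_distrib_right power_mult_distrib)
    finally have "l2_norm (A *\<^sub>v v) \<le> sqrt C * l2_norm v"
      by (rule power2_le_imp_le) (simp add: C)
    then show ?thesis
      by (simp add: distrib_right add_increasing2)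
  qed
  moreover have "0 < sqrt C + 1" using C by (simp add: add_nonneg_pos)
  ultimately show ?thesis by blast
qed

text \<open>\<open>Sup\<close> on the reals says something only about nonempty sets bounded above,
  so boundedness comes first. The estimate on the unit ball then extends to all vectors by
  scaling.\<close>

lemma
  assumes A: "A \<in> carrier_mat p m"
  shows spectral_norm_nonneg: "0 \<le> spectral_norm A"
    and l2_norm_mult_mat_vec_le:
      "v \<in> carrier_vec m \<Longrightarrow> l2_norm (A *\<^sub>v v) \<le> spectral_norm A * l2_norm v"
proof -
  let ?X = "{l2_norm (A *\<^sub>v v) | v. v \<in> carrier_vec (dim_col A) \<and> l2_norm v \<le> 1}"
  obtain K where K: "0 < K" "\<And>v. v \<in> carrier_vec m \<Longrightarrow> l2_norm (A *\<^sub>v v) \<le> K * l2_norm v"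
    using mult_mat_vec_bounded[OF A] by blast
  have "bdd_above ?X"
  proof (rule bdd_aboveI[of _ K])
    fix a assume "a \<in> ?X"
    then obtain v where v: "v \<in> carrier_vec m" "l2_norm v \<le> 1" "a = l2_norm (A *\<^sub>v v)"
      using A by auto
    have "K * l2_norm v \<le> K * 1" using K(1) v(2) by (intro mult_left_mono) auto
    with K(2)[OF v(1)] v(3) show "a \<le> K" by simp
  qed
  then have upper: "l2_norm (A *\<^sub>v v) \<le> spectral_norm A"
    if "v \<in> carrier_vec m" "l2_norm v \<le> 1" for v
    unfolding spectral_norm_def using that A by (intro cSup_upper) auto
  have zero: "l2_norm (0\<^sub>v m) = 0" by (simp add: l2_norm_def)
  from upper[of "0\<^sub>v m"] zero show nonneg: "0 \<le> spectral_norm A"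
    by (auto intro: order_trans[OF l2_norm_nonneg])
  assume v: "v \<in> carrier_vec m"
  show "l2_norm (A *\<^sub>v v) \<le> spectral_norm A * l2_norm v"
  \<comment> \<open>A vector of norm zero cannot be normalized; there the crude bound with
    \<open>K\<close> already gives zero.\<close>
  proof (cases "l2_norm v = 0")
    case True
    with K(2)[OF v] show ?thesis by simp
  next
    case False
    then have pos: "0 < l2_norm v" by (simp add: order_less_le)
    have "l2_norm (A *\<^sub>v ((1 / l2_norm v) \<cdot>\<^sub>v v)) \<le> spectral_norm A"
      using v pos by (intro upper) (auto simp: l2_norm_smult)
    then show ?thesis
      using pos by (simp add: mult_mat_vec[OF A v] l2_norm_smult field_simps)
  qed
qed

section \<open>The smallest singular value\<close>

text \<open>
  The eigenvalue is the largest \<open>c\<close> with \<open>c I \<preceq> A\<close>: if \<open>B = A - c I\<close> were invertible, Cauchy-Schwarz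
  for the form of \<open>B\<close> applied to \<open>v\<close> and \<open>B\<inverse> v\<close> would bound \<open>B\<close> below by a positive multiple of \<open>I\<close>.
\<close>

lemma psd_smallest_eigenvalue:
  assumes psd: "psd A" and A: "A \<in> carrier_mat m m" and m: "0 < m"
  shows "\<exists>c. eigenvalue A c \<and> (\<forall>v\<in>carrier_vec m. c * (v \<bullet> v) \<le> v \<bullet> (A *\<^sub>v v))"
proof -
  define X where "X = {c. \<forall>v\<in>carrier_vec m. c * (v \<bullet> v) \<le> v \<bullet> (A *\<^sub>v v)}"
  define c where "c = Sup X"
  have sym: "transpose_mat A = A" and nonneg: "\<And>v. v \<in> carrier_vec m \<Longrightarrow> 0 \<le> v \<bullet> (A *\<^sub>v v)"
    using psd A by (auto simp: psd_def)
  have X0: "0 \<in> X" using nonneg by (simp add: X_def)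
  \<comment> \<open>The first unit vector exists because \<open>0 < m\<close>; its Rayleigh quotient
    is an upper bound.\<close>
  have bdd: "bdd_above X"
  proof (rule bdd_aboveI)
    fix b assume "b \<in> X"
    then have "b * ((unit_vec m 0 :: real vec) \<bullet> unit_vec m 0)
        \<le> unit_vec m 0 \<bullet> (A *\<^sub>v unit_vec m 0)"
      unfolding X_def by simp
    with m show "b \<le> unit_vec m 0 \<bullet> (A *\<^sub>v unit_vec m 0)" by simp
  qed
  \<comment> \<open>The supremum is attained: the Rayleigh quotient of each nonzero \<open>v\<close>
    is an upper bound of \<open>X\<close>, hence at least \<open>c\<close>.\<close>
  have cX: "c * (v \<bullet> v) \<le> v \<bullet> (A *\<^sub>v v)" if v: "v \<in> carrier_vec m" for v
  proof (cases "v \<bullet> v = 0")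
    case True
    with nonneg[OF v] show ?thesis by simp
  next
    case False
    then have pos: "0 < v \<bullet> v" using scalar_prod_self_nonneg[of v] by simp
    have "c \<le> (v \<bullet> (A *\<^sub>v v)) / (v \<bullet> v)"
      unfolding c_def
    proof (rule cSup_least)
      show "X \<noteq> {}" using X0 by blast
      show "b \<le> (v \<bullet> (A *\<^sub>v v)) / (v \<bullet> v)" if "b \<in> X" for b
        using that v pos by (simp add: X_def field_simps)
    qed
    with pos show ?thesis by (simp add: field_simps)
  qed
  define B where "B = char_matrix A c"
  have B: "B \<in> carrier_mat m m" using A by (simp add: B_def)
  have symB: "transpose_mat B = B"
  proof -
    have "transpose_mat B = transpose_mat A + transpose_mat ((- c) \<cdot>\<^sub>m 1\<^sub>m m)"
      using A by (simp add: B_def char_matrix_def transpose_add)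
    also have "transpose_mat ((- c) \<cdot>\<^sub>m 1\<^sub>m m) = (- c) \<cdot>\<^sub>m 1\<^sub>m m"
      by (intro eq_matI) auto
    finally show ?thesis using A sym by (simp add: B_def char_matrix_def)
  qed
  have Bv: "v \<bullet> (B *\<^sub>v v) = v \<bullet> (A *\<^sub>v v) - c * (v \<bullet> v)" if v: "v \<in> carrier_vec m" for v
  proof -
    have "((- c) \<cdot>\<^sub>m 1\<^sub>m m) *\<^sub>v v = (- c) \<cdot>\<^sub>v v"
      using v by (intro eq_vecI) auto
    then have "B *\<^sub>v v = A *\<^sub>v v + (- c) \<cdot>\<^sub>v v"
      using A v by (simp add: B_def char_matrix_def add_mult_distrib_mat_vec[of _ m m])
    then show ?thesis
      using A v by (simp add: scalar_prod_add_distrib[of _ m])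
  qed
  have psdB: "psd B" using B symB Bv cX by (auto simp: psd_def)
  have "eigenvalue A c"
  proof (rule ccontr)
    assume "\<not> eigenvalue A c"
    then have "det B \<noteq> 0" using eigenvalue_det[OF A] by (simp add: B_def)
    \<comment> \<open>A nonzero determinant makes \<open>B\<close> a unit of the matrix ring;
      \<open>()\<close> fills the extension slot of the ring record.\<close>
    from det_non_zero_imp_unit[OF B this, of "()"]
    obtain C where C: "C \<in> carrier_mat m m" "B * C = 1\<^sub>m m"
      by (auto simp: Units_def ring_mat_def)
    obtain K where K: "0 < K" "\<And>v. v \<in> carrier_vec m \<Longrightarrow> l2_norm (C *\<^sub>v v) \<le> K * l2_norm v"
      using mult_mat_vec_bounded[OF C(1)] by blast
    \<comment> \<open>A bound \<open>K\<close> on the inverse would put \<open>c + 1 / K\<close>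
      into \<open>X\<close>, above its supremum.\<close>
    have "(c + 1 / K) * (v \<bullet> v) \<le> v \<bullet> (A *\<^sub>v v)" if v: "v \<in> carrier_vec m" for v
    proof (cases "v \<bullet> v = 0")
      case True
      with nonneg[OF v] show ?thesis by simp
    next
      case False
      then have pos: "0 < v \<bullet> v" using scalar_prod_self_nonneg[of v] by simp
      have Cv: "C *\<^sub>v v \<in> carrier_vec m" using C v by simp
      have BC: "B *\<^sub>v (C *\<^sub>v v) = v"
        using assoc_mult_mat_vec[OF B C(1) v] C(2) v by simp
      have Bv0: "0 \<le> v \<bullet> (B *\<^sub>v v)" using Bv[OF v] cX[OF v] by simp
      have "(C *\<^sub>v v) \<bullet> v \<le> l2_norm (C *\<^sub>v v) * l2_norm v"
        using Cauchy_Schwarz_l2_norm[OF Cv v] by simp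
      also have "\<dots> \<le> K * l2_norm v * l2_norm v"
        using K(2)[OF v] by (intro mult_right_mono) auto
      also have "\<dots> = K * (v \<bullet> v)"
        using l2_norm_power2[of v] by (simp add: power2_eq_square)
      finally have CK: "(C *\<^sub>v v) \<bullet> v \<le> K * (v \<bullet> v)" .
      have "(v \<bullet> v)\<^sup>2 \<le> (v \<bullet> (B *\<^sub>v v)) * ((C *\<^sub>v v) \<bullet> v)"
        using psd_Cauchy_Schwarz[OF psdB B v Cv] BC by simp
      also have "\<dots> \<le> (v \<bullet> (B *\<^sub>v v)) * (K * (v \<bullet> v))"
        using CK Bv0 by (rule mult_left_mono)
      finally have "v \<bullet> v \<le> K * (v \<bullet> (B *\<^sub>v v))"
        using pos by (simp add: power2_eq_square mult.commute)
      with K(1) have "1 / K * (v \<bullet> v) \<le> v \<bullet> (B *\<^sub>v v)" by (simp add: field_simps)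
      with Bv[OF v] show ?thesis by (simp add: distrib_right)
    qed
    then have "c + 1 / K \<in> X" by (simp add: X_def)
    then have "c + 1 / K \<le> c" unfolding c_def using bdd by (rule cSup_upper)
    with K(1) show False by simp
  qed
  with cX show ?thesis by blast
qed

lemma scalar_prod_gram:
  assumes "(M :: real mat) \<in> carrier_mat p m" "v \<in> carrier_vec m" "w \<in> carrier_vec m"
  shows "v \<bullet> ((transpose_mat M * M) *\<^sub>v w) = (M *\<^sub>v v) \<bullet> (M *\<^sub>v w)"
proof -
  have "(transpose_mat M * M) *\<^sub>v w = transpose_mat M *\<^sub>v (M *\<^sub>v w)"
    using assms by (intro assoc_mult_mat_vec[of _ m p _ m]) auto
  moreover have "v \<bullet> (transpose_mat M *\<^sub>v (M *\<^sub>v w)) = (transpose_mat M *\<^sub>v (M *\<^sub>v w)) \<bullet> v"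
    using assms by (intro comm_scalar_prod[of _ m]) auto
  moreover have "(transpose_mat M *\<^sub>v (M *\<^sub>v w)) \<bullet> v = (M *\<^sub>v w) \<bullet> (M *\<^sub>v v)"
    using assms by (intro transpose_vec_mult_scalar[of _ p m]) auto
  moreover have "(M *\<^sub>v w) \<bullet> (M *\<^sub>v v) = (M *\<^sub>v v) \<bullet> (M *\<^sub>v w)"
    using assms by (intro comm_scalar_prod[of _ p]) auto
  ultimately show ?thesis by simp
qed

text \<open>For an eigenvector \<open>v\<close> of the Gram matrix,
  \<open>\<mu> * (v \<bullet> v)\<close> is the squared norm of \<open>M v\<close>, so injectivity
  makes every eigenvalue positive. The estimate follows because \<open>sqrt c\<close> is itself a
  singular value for the eigenvalue \<open>c\<close> that bounds the Gram form below.\<close>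

lemma
  assumes M: "M \<in> carrier_mat p m" and m: "0 < m"
    and inj: "\<And>v. v \<in> carrier_vec m \<Longrightarrow> M *\<^sub>v v = 0\<^sub>v p \<Longrightarrow> v = 0\<^sub>v m"
  shows sigma_min_pos: "0 < sigma_min M"
    and sigma_min_le: "v \<in> carrier_vec m \<Longrightarrow> (sigma_min M)\<^sup>2 * (v \<bullet> v) \<le> (M *\<^sub>v v) \<bullet> (M *\<^sub>v v)"
proof -
  define A where "A = transpose_mat M * M"
  have A: "A \<in> carrier_mat m m" using M by (simp add: A_def)
  have Av: "v \<bullet> (A *\<^sub>v v) = (M *\<^sub>v v) \<bullet> (M *\<^sub>v v)" if "v \<in> carrier_vec m" for v
    using scalar_prod_gram[OF M that that] by (simp add: A_def)
  have "transpose_mat A = A"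
    using M unfolding A_def by (simp add: transpose_mult[of _ m p _ m])
  then have "psd A" using A Av by (auto simp: psd_def scalar_prod_self_nonneg)
  from psd_smallest_eigenvalue[OF this A m] obtain c where
    c: "eigenvalue A c" "\<And>v. v \<in> carrier_vec m \<Longrightarrow> c * (v \<bullet> v) \<le> v \<bullet> (A *\<^sub>v v)" by blast
  have pos: "0 < \<mu>" if \<mu>: "eigenvalue A \<mu>" for \<mu>
  proof -
    obtain v where v: "v \<in> carrier_vec m" "v \<noteq> 0\<^sub>v m" "A *\<^sub>v v = \<mu> \<cdot>\<^sub>v v"
      using \<mu> A by (auto simp: eigenvalue_def eigenvector_def)
    have Mv: "M *\<^sub>v v \<in> carrier_vec p" using M v by simp
    have "0 < (M *\<^sub>v v) \<bullet> (M *\<^sub>v v)"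
      using inj[OF v(1)] v(2) scalar_prod_self_eq_0_iff[OF Mv] scalar_prod_self_nonneg[of "M *\<^sub>v v"]
      by fastforce
    then have "0 < \<mu> * (v \<bullet> v)" using Av[OF v(1)] v by simp
    then show ?thesis
      using scalar_prod_self_nonneg[of v] by (simp add: zero_less_mult_iff)
  qed
  have eq: "singular_values M = sqrt ` {\<mu>. eigenvalue A \<mu>}"
    by (auto simp: singular_values_def A_def)
  \<comment> \<open>\<open>Min\<close> is informative only on a finite nonempty set; finiteness
    comes from the roots of the characteristic polynomial.\<close>
  have "{\<mu>. eigenvalue A \<mu>} = {\<mu>. poly (char_poly A) \<mu> = 0}"
    using eigenvalue_root_char_poly[OF A] by simp
  moreover have "char_poly A \<noteq> 0"
    using degree_monic_char_poly[OF A] by auto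
  ultimately have fin: "finite (singular_values M)"
    unfolding eq by (simp add: poly_roots_finite)
  have ne: "singular_values M \<noteq> {}" using c(1) eq by auto
  show sp: "0 < sigma_min M"
    using Min_in[OF fin ne] pos unfolding sigma_min_def by (auto simp: eq)
  have "sigma_min M \<le> sqrt c"
    unfolding sigma_min_def using fin c(1) by (intro Min_le) (auto simp: eq)
  then have "(sigma_min M)\<^sup>2 \<le> (sqrt c)\<^sup>2" using sp by (intro power_mono) auto
  then have le: "(sigma_min M)\<^sup>2 \<le> c" using pos[OF c(1)] by simp
  assume v: "v \<in> carrier_vec m"
  have "(sigma_min M)\<^sup>2 * (v \<bullet> v) \<le> c * (v \<bullet> v)"
    using le scalar_prod_self_nonneg by (rule mult_right_mono)
  with c(2)[OF v] Av[OF v] show "(sigma_min M)\<^sup>2 * (v \<bullet> v) \<le> (M *\<^sub>v v) \<bullet> (M *\<^sub>v v)" by simp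
qed

section \<open>Coercivity of the stacked matrix\<close>

text \<open>The lower blocks in \<open>append_cols\<close> have no rows, so the product formula for
  four blocks yields the sum followed by an empty vector.\<close>

lemma append_cols_mult_vec:
  assumes "A \<in> carrier_mat p m\<^sub>1" "B \<in> carrier_mat p m\<^sub>2"
    and "a \<in> carrier_vec m\<^sub>1" "b \<in> carrier_vec m\<^sub>2"
  shows "append_cols A B *\<^sub>v (a @\<^sub>v b) = A *\<^sub>v a + B *\<^sub>v b"
proof -
  have "append_cols A B *\<^sub>v (a @\<^sub>v b)
      = (A *\<^sub>v a + B *\<^sub>v b) @\<^sub>v (0\<^sub>m 0 m\<^sub>1 *\<^sub>v a + 0\<^sub>m 0 m\<^sub>2 *\<^sub>v b)"
    unfolding append_cols_def using assms
    by (subst four_block_mat_mult_vec[of _ p m\<^sub>1 _ m\<^sub>2 _ 0]) auto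
  also have "\<dots> = A *\<^sub>v a + B *\<^sub>v b"
    using assms by (intro eq_vecI) auto
  finally show ?thesis .
qed

text \<open>The square roots in \<open>M_mat\<close> are chosen so that this is the quadratic form
  of the problem with both weights equal to \<open>omin\<close> times the identity.\<close>

lemma M_mat_mult_vec_square:
  assumes "u \<in> carrier_vec (3 * (h * w))" and "0 \<le> lam1 * omin" "0 \<le> lam2 * omin"
  shows "(M_mat h w lam1 lam2 omin *\<^sub>v u) \<bullet> (M_mat h w lam1 lam2 omin *\<^sub>v u)
    = (S_mat h w *\<^sub>v u) \<bullet> (S_mat h w *\<^sub>v u)
      + lam1 * omin * ((G_mat h w *\<^sub>v u) \<bullet> (G_mat h w *\<^sub>v u))
      + lam2 * omin * ((R_mat h w *\<^sub>v u) \<bullet> (R_mat h w *\<^sub>v u))"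
proof -
  let ?N = "3 * (h * w)" and ?n = "h * w" and ?m = "2 * (h * w)"
  let ?S = "S_mat h w" and ?G = "G_mat h w" and ?R = "R_mat h w"
  let ?a = "sqrt (lam1 * omin)" and ?b = "sqrt (lam2 * omin)"
  note d = dims(3-5)[of h w]
  have aG: "(?a \<cdot>\<^sub>m ?G) *\<^sub>v u = ?a \<cdot>\<^sub>v (?G *\<^sub>v u)" and bR: "(?b \<cdot>\<^sub>m ?R) *\<^sub>v u = ?b \<cdot>\<^sub>v (?R *\<^sub>v u)"
    using d assms(1) by (auto intro!: eq_vecI)
  have "M_mat h w lam1 lam2 omin *\<^sub>v u
      = (?S *\<^sub>v u) @\<^sub>v (?a \<cdot>\<^sub>v (?G *\<^sub>v u)) @\<^sub>v (?b \<cdot>\<^sub>v (?R *\<^sub>v u))"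
    unfolding M_mat_def using d assms(1)
    by (subst mat_mult_append[of _ ?n ?N _ "?m + ?m", OF _ carrier_append_rows])
      (auto simp: aG bR mat_mult_append[of _ ?m ?N _ ?m])
  moreover have "?S *\<^sub>v u \<in> carrier_vec ?n" "?G *\<^sub>v u \<in> carrier_vec ?m" "?R *\<^sub>v u \<in> carrier_vec ?m"
    using d assms(1) by auto
  moreover have "(s @\<^sub>v g @\<^sub>v q) \<bullet> (s @\<^sub>v g @\<^sub>v q) = s \<bullet> s + (g \<bullet> g + q \<bullet> q)"
    if "s \<in> carrier_vec ?n" "g \<in> carrier_vec ?m" "q \<in> carrier_vec ?m" for s g q :: "real vec"
    using that scalar_prod_append[of s ?n "g @\<^sub>v q" "?m + ?m" s "g @\<^sub>v q"]
      scalar_prod_append[of g ?m q ?m g q] by (metis append_carrier_vec)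
  moreover have "(sqrt c \<cdot>\<^sub>v x) \<bullet> (sqrt c \<cdot>\<^sub>v x) = c * (x \<bullet> x)" if "0 \<le> c" for c x
    using that by (simp add: mult.assoc[symmetric])
  ultimately show ?thesis
    using assms(2,3) by (simp del: scalar_prod_smult_left scalar_prod_smult_right
        smult_scalar_prod_distrib scalar_prod_smult_distrib)
qed

text \<open>For \<open>u = p @\<^sub>v q\<close> the product with \<open>R_mat\<close> is
  \<open>q\<close>, and once \<open>q\<close> vanishes the product with \<open>S_mat\<close> is
  \<open>p\<close>. This yields the injectivity of the stacked matrix.\<close>

lemma S_R_mult_vec_eq_0:
  assumes u: "u \<in> carrier_vec (3 * (h * w))"
    and S: "S_mat h w *\<^sub>v u = 0\<^sub>v (h * w)" and R: "R_mat h w *\<^sub>v u = 0\<^sub>v (2 * (h * w))"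
  shows "u = 0\<^sub>v (3 * (h * w))"
proof -
  let ?n = "h * w" and ?m = "2 * (h * w)"
  define p where "p = vec_first u ?n"
  define q where "q = vec_last u ?m"
  have pq: "p \<in> carrier_vec ?n" "q \<in> carrier_vec ?m" by (auto simp: p_def q_def)
  have u': "u = p @\<^sub>v q"
    using u vec_first_last_append[of u ?n ?m] by (simp add: p_def q_def)
  note N = dims(2)[of h w]
  have "R_mat h w *\<^sub>v u = 0\<^sub>m ?m ?n *\<^sub>v p + 1\<^sub>m ?m *\<^sub>v q"
    unfolding R_mat_def u' using pq by (intro append_cols_mult_vec) auto
  also have "0\<^sub>m ?m ?n *\<^sub>v p = 0\<^sub>v ?m" using pq by (intro eq_vecI) auto
  also have "0\<^sub>v ?m + 1\<^sub>m ?m *\<^sub>v q = q" using pq by simp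
  finally have q: "q = 0\<^sub>v ?m" using R by simp
  have "S_mat h w *\<^sub>v u = 1\<^sub>m ?n *\<^sub>v p + (- transpose_mat (nabla h w)) *\<^sub>v q"
    unfolding S_mat_def u' using pq N by (intro append_cols_mult_vec) auto
  also have "\<dots> = p" using pq N q by (auto intro!: eq_vecI)
  finally have "p = 0\<^sub>v ?n" using S by simp
  with q show ?thesis unfolding u' by (intro eq_vecI) auto
qed

lemma
  assumes hw: "0 < h * w" and lam: "0 < lam1" "0 < lam2" and omin: "0 < omin"
  shows alpha_pos: "0 < alpha h w lam1 lam2 omin"
    and alpha_coercive: "u \<in> carrier_vec (3 * (h * w)) \<Longrightarrow>
      alpha h w lam1 lam2 omin * (u \<bullet> u)
        \<le> (S_mat h w *\<^sub>v u) \<bullet> (S_mat h w *\<^sub>v u)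
          + lam1 * omin * ((G_mat h w *\<^sub>v u) \<bullet> (G_mat h w *\<^sub>v u))
          + lam2 * omin * ((R_mat h w *\<^sub>v u) \<bullet> (R_mat h w *\<^sub>v u))"
proof -
  let ?M = "M_mat h w lam1 lam2 omin" and ?N = "3 * (h * w)"
  let ?p = "h * w + (2 * (h * w) + 2 * (h * w))"
  have M: "?M \<in> carrier_mat ?p ?N"
    unfolding M_mat_def using dims(3-5)[of h w] by (intro carrier_append_rows) auto
  have nn: "0 \<le> lam1 * omin" "0 \<le> lam2 * omin" and pos: "0 < lam1 * omin" "0 < lam2 * omin"
    using lam omin by auto
  note sq = M_mat_mult_vec_square[OF _ nn]
  have inj: "v = 0\<^sub>v ?N" if v: "v \<in> carrier_vec ?N" and Mv: "?M *\<^sub>v v = 0\<^sub>v ?p" for v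
  proof -
    let ?s = "(S_mat h w *\<^sub>v v) \<bullet> (S_mat h w *\<^sub>v v)"
    let ?g = "lam1 * omin * ((G_mat h w *\<^sub>v v) \<bullet> (G_mat h w *\<^sub>v v))"
    let ?r = "lam2 * omin * ((R_mat h w *\<^sub>v v) \<bullet> (R_mat h w *\<^sub>v v))"
    \<comment> \<open>Nonnegative terms with sum zero vanish separately.\<close>
    have "0 = ?s + ?g + ?r" using sq[OF v] Mv by simp
    moreover have "0 \<le> ?s" "0 \<le> ?g" "0 \<le> ?r"
      using nn by (simp_all add: scalar_prod_self_nonneg)
    ultimately have "?s = 0" "?r = 0" by linarith+
    then have "?s = 0" "(R_mat h w *\<^sub>v v) \<bullet> (R_mat h w *\<^sub>v v) = 0"
      using pos(2) by (auto simp del: mult_eq_0_iff simp: mult_eq_0_iff[of "lam2 * omin"])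
    then have "S_mat h w *\<^sub>v v = 0\<^sub>v (h * w)" "R_mat h w *\<^sub>v v = 0\<^sub>v (2 * (h * w))"
      using dims(3,5)[of h w] v
      by (simp_all add: scalar_prod_self_eq_0_iff[of _ "h * w"]
          scalar_prod_self_eq_0_iff[of _ "2 * (h * w)"])
    then show ?thesis by (rule S_R_mult_vec_eq_0[OF v])
  qed
  have N: "0 < ?N" using hw by simp
  show "0 < alpha h w lam1 lam2 omin"
    using sigma_min_pos[OF M N inj] by (simp add: alpha_def)
  show "alpha h w lam1 lam2 omin * (u \<bullet> u)
        \<le> (S_mat h w *\<^sub>v u) \<bullet> (S_mat h w *\<^sub>v u)
          + lam1 * omin * ((G_mat h w *\<^sub>v u) \<bullet> (G_mat h w *\<^sub>v u))
          + lam2 * omin * ((R_mat h w *\<^sub>v u) \<bullet> (R_mat h w *\<^sub>v u))"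
    if "u \<in> carrier_vec ?N"
    using sigma_min_le[OF M N inj that] sq[OF that] by (simp add: alpha_def)
qed

section \<open>Diagonal weights\<close>

lemma diagonal_scalar_prod:
  assumes "(D :: real mat) \<in> carrier_mat m m" "diagonal_mat D"
    and "x \<in> carrier_vec m" "y \<in> carrier_vec m"
  shows "x \<bullet> (D *\<^sub>v y) = (\<Sum>i<m. D $$ (i, i) * (x $ i * y $ i))"
proof -
  have "(D *\<^sub>v y) $ i = D $$ (i, i) * y $ i" if i: "i < m" for i
  proof -
    have "(D *\<^sub>v y) $ i = (\<Sum>j<m. D $$ (i, j) * y $ j)"
      using assms i by (simp add: scalar_prod_def atLeast0LessThan)
    also have "\<dots> = (\<Sum>j<m. if j = i then D $$ (i, i) * y $ i else 0)"
      using assms i by (intro sum.cong) (auto simp: diagonal_mat_def)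
    also have "\<dots> = D $$ (i, i) * y $ i" using i by simp
    finally show ?thesis .
  qed
  then show ?thesis
    using assms by (auto simp: scalar_prod_def[of x] atLeast0LessThan intro!: sum.cong)
qed

text \<open>For diagonal matrices an entrywise bound acts as an operator bound without a dimension
  factor. This is why the sup norm on weights matches the Euclidean norm on vectors.\<close>

lemma diagonal_scalar_prod_diff_le:
  assumes D: "(D :: real mat) \<in> carrier_mat m m" "diagonal_mat D"
    and E: "E \<in> carrier_mat m m" "diagonal_mat E"
    and \<delta>: "\<And>i. i < m \<Longrightarrow> \<bar>D $$ (i, i) - E $$ (i, i)\<bar> \<le> \<delta>" "0 \<le> \<delta>"
    and xy: "x \<in> carrier_vec m" "y \<in> carrier_vec m"
  shows "x \<bullet> (D *\<^sub>v y) - x \<bullet> (E *\<^sub>v y) \<le> \<delta> * l2_norm x * l2_norm y"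
proof -
  \<comment> \<open>Passing to absolute values keeps the Euclidean norms and prevents cancellation
    between entries from spoiling the termwise bound.\<close>
  define x' where "x' = vec m (\<lambda>i. \<bar>x $ i\<bar>)"
  define y' where "y' = vec m (\<lambda>i. \<bar>y $ i\<bar>)"
  have "x \<bullet> (D *\<^sub>v y) - x \<bullet> (E *\<^sub>v y)
      = (\<Sum>i<m. (D $$ (i, i) - E $$ (i, i)) * (x $ i * y $ i))"
    using diagonal_scalar_prod[OF D xy] diagonal_scalar_prod[OF E xy]
    by (simp add: sum_subtractf left_diff_distrib)
  also have "\<dots> \<le> (\<Sum>i<m. \<delta> * (\<bar>x $ i\<bar> * \<bar>y $ i\<bar>))"
  proof (rule sum_mono)
    fix i assume "i \<in> {..<m}"
    then have "\<bar>D $$ (i, i) - E $$ (i, i)\<bar> * (\<bar>x $ i\<bar> * \<bar>y $ i\<bar>) \<le> \<delta> * (\<bar>x $ i\<bar> * \<bar>y $ i\<bar>)"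
      using \<delta>(1)[of i] by (intro mult_right_mono) auto
    then show "(D $$ (i, i) - E $$ (i, i)) * (x $ i * y $ i) \<le> \<delta> * (\<bar>x $ i\<bar> * \<bar>y $ i\<bar>)"
      using abs_ge_self[of "(D $$ (i, i) - E $$ (i, i)) * (x $ i * y $ i)"] by (simp add: abs_mult)
  qed
  also have "\<dots> = \<delta> * (x' \<bullet> y')"
    by (simp add: x'_def y'_def scalar_prod_def sum_distrib_left atLeast0LessThan)
  also have "\<dots> \<le> \<delta> * (l2_norm x' * l2_norm y')"
    using Cauchy_Schwarz_l2_norm[of x' m y'] \<delta>(2)
    by (intro mult_left_mono) (auto simp: x'_def y'_def)
  also have "l2_norm x' = l2_norm x"
    using xy by (simp add: l2_norm_def x'_def scalar_prod_def)
  also have "l2_norm y' = l2_norm y"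
    using xy by (simp add: l2_norm_def y'_def scalar_prod_def)
  finally show ?thesis by (simp add: mult.assoc)
qed

lemma diagonal_mat_symmetric:
  assumes "(D :: 'a :: zero mat) \<in> carrier_mat m m" "diagonal_mat D"
  shows "transpose_mat D = D"
  using assms by (intro eq_matI) (auto simp: diagonal_mat_def, metis)

lemma admissible_weight_lower:
  assumes W: "admissible_weight m omin omax W" and x: "x \<in> carrier_vec m"
  shows "omin * (x \<bullet> x) \<le> x \<bullet> (W *\<^sub>v x)"
proof -
  have c: "W \<in> carrier_mat m m" "psd (W - omin \<cdot>\<^sub>m 1\<^sub>m m)"
    using W by (auto simp: admissible_weight_def loewner_le_def)
  then have "0 \<le> x \<bullet> ((W - omin \<cdot>\<^sub>m 1\<^sub>m m) *\<^sub>v x)"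
    using x by (auto simp: psd_def)
  also have "(W - omin \<cdot>\<^sub>m 1\<^sub>m m) *\<^sub>v x = W *\<^sub>v x - (omin \<cdot>\<^sub>m 1\<^sub>m m) *\<^sub>v x"
    using c x by (intro minus_mult_distrib_mat_vec) auto
  also have "(omin \<cdot>\<^sub>m 1\<^sub>m m) *\<^sub>v x = omin \<cdot>\<^sub>v x"
    using x by (intro eq_vecI) auto
  finally show ?thesis
    using c x by (simp add: scalar_prod_minus_distrib[of _ m])
qed

lemma linf_norm_ge:
  assumes "i < dim_vec v"
  shows "\<bar>v $ i\<bar> \<le> linf_norm v"
proof -
  have "{\<bar>v $ i\<bar> | i. i < dim_vec v} = (\<lambda>i. \<bar>v $ i\<bar>) ` {..<dim_vec v}" by auto
  then show ?thesis unfolding linf_norm_def using assms by (intro Max_ge) auto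
qed

lemma
  assumes D: "D \<in> carrier_mat m m" and E: "E \<in> carrier_mat m m" and i: "i < m"
  shows weight_norm_fst: "\<bar>D $$ (i, i)\<bar> \<le> weight_norm (D, E)"
    and weight_norm_snd: "\<bar>E $$ (i, i)\<bar> \<le> weight_norm (D, E)"
proof -
  let ?v = "vec_of_list (diag_mat D) @\<^sub>v vec_of_list (diag_mat E)"
  have d: "dim_vec (vec_of_list (diag_mat D)) = m" "dim_vec (vec_of_list (diag_mat E)) = m"
    using D E by (auto simp: diag_mat_def)
  have "?v $ i = D $$ (i, i)" "?v $ (m + i) = E $$ (i, i)"
    using d i D E by (auto simp: diag_mat_def vec_of_list_index)
  with linf_norm_ge[of i ?v] linf_norm_ge[of "m + i" ?v] d i
  show "\<bar>D $$ (i, i)\<bar> \<le> weight_norm (D, E)" "\<bar>E $$ (i, i)\<bar> \<le> weight_norm (D, E)"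
    by (auto simp: weight_norm_def)
qed

section \<open>Weighted least squares\<close>

text \<open>The analysis rests on dimensions, positive parameters and one coercivity constant
  \<open>a\<close>; the discrete gradient enters only through the later interpretation.\<close>

locale coercive_least_squares =
  fixes S G R :: "real mat" and n m N :: nat and lam1 lam2 omin a :: real
  assumes S: "S \<in> carrier_mat n N" and G: "G \<in> carrier_mat m N" and R: "R \<in> carrier_mat m N"
    and lam: "0 < lam1" "0 < lam2" and a: "0 < a"
    and coercive: "u \<in> carrier_vec N \<Longrightarrow>
      a * (u \<bullet> u) \<le> (S *\<^sub>v u) \<bullet> (S *\<^sub>v u) + lam1 * omin * ((G *\<^sub>v u) \<bullet> (G *\<^sub>v u))
        + lam2 * omin * ((R *\<^sub>v u) \<bullet> (R *\<^sub>v u))"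
begin

text \<open>Diagonality is relaxed to symmetry, which makes the energy symmetric; the lower bound
  makes it coercive.\<close>

definition weight :: "real mat \<Rightarrow> bool" where
  "weight D \<longleftrightarrow> D \<in> carrier_mat m m \<and> transpose_mat D = D
     \<and> (\<forall>x\<in>carrier_vec m. omin * (x \<bullet> x) \<le> x \<bullet> (D *\<^sub>v x))"

definition energy :: "real mat \<times> real mat \<Rightarrow> real vec \<Rightarrow> real vec \<Rightarrow> real" where
  "energy D u v = (S *\<^sub>v u) \<bullet> (S *\<^sub>v v) + lam1 * ((G *\<^sub>v u) \<bullet> (fst D *\<^sub>v (G *\<^sub>v v)))
     + lam2 * ((R *\<^sub>v u) \<bullet> (snd D *\<^sub>v (R *\<^sub>v v)))"

definition cost :: "real vec \<Rightarrow> real mat \<times> real mat \<Rightarrow> real vec \<Rightarrow> real" where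
  "cost f D u = 1 / 2 * (l2_norm (S *\<^sub>v u - f))\<^sup>2
     + lam1 / 2 * ((G *\<^sub>v u) \<bullet> (fst D *\<^sub>v (G *\<^sub>v u)))
     + lam2 / 2 * ((R *\<^sub>v u) \<bullet> (snd D *\<^sub>v (R *\<^sub>v u)))"

text \<open>This is the normal equation \<open>A u = S^T f\<close> tested against every
  \<open>v\<close>, the first-order condition for a minimizer.\<close>

definition weak_solution :: "real vec \<Rightarrow> real mat \<times> real mat \<Rightarrow> real vec \<Rightarrow> bool" where
  "weak_solution f D u \<longleftrightarrow>
     u \<in> carrier_vec N \<and> (\<forall>v\<in>carrier_vec N. energy D u v = f \<bullet> (S *\<^sub>v v))"

section \<open>The variational problem for one fixed pair of weights\<close>

context
  fixes D :: "real mat \<times> real mat"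
  assumes D: "weight (fst D)" "weight (snd D)"
begin

lemma carriers:
  assumes "u \<in> carrier_vec N"
  shows "S *\<^sub>v u \<in> carrier_vec n" "G *\<^sub>v u \<in> carrier_vec m" "R *\<^sub>v u \<in> carrier_vec m"
    "fst D *\<^sub>v (G *\<^sub>v u) \<in> carrier_vec m" "snd D *\<^sub>v (R *\<^sub>v u) \<in> carrier_vec m"
  using assms S G R D by (auto simp: weight_def)

lemma energy_commute:
  assumes "u \<in> carrier_vec N" "v \<in> carrier_vec N"
  shows "energy D u v = energy D v u"
  unfolding energy_def
  using D carriers[OF assms(1)] carriers[OF assms(2)]
  by (simp add: comm_scalar_prod[of "S *\<^sub>v u" n] weight_def
      symmetric_scalar_prod[of "fst D" m "G *\<^sub>v u"] symmetric_scalar_prod[of "snd D" m "R *\<^sub>v u"])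

lemma energy_diff:
  assumes "u \<in> carrier_vec N" "v \<in> carrier_vec N" "z \<in> carrier_vec N"
  shows "energy D (u - v) z = energy D u z - energy D v z"
  unfolding energy_def
  using carriers[OF assms(1)] carriers[OF assms(2)] carriers[OF assms(3)] assms
  by (simp add: mult_minus_distrib_mat_vec[OF S] mult_minus_distrib_mat_vec[OF G]
      mult_minus_distrib_mat_vec[OF R] minus_scalar_prod_distrib[of _ n]
      minus_scalar_prod_distrib[of _ m] algebra_simps)

lemma energy_coercive:
  assumes u: "u \<in> carrier_vec N"
  shows "a * (u \<bullet> u) \<le> energy D u u"
proof -
  have "lam1 * (omin * ((G *\<^sub>v u) \<bullet> (G *\<^sub>v u))) \<le> lam1 * ((G *\<^sub>v u) \<bullet> (fst D *\<^sub>v (G *\<^sub>v u)))"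
    "lam2 * (omin * ((R *\<^sub>v u) \<bullet> (R *\<^sub>v u))) \<le> lam2 * ((R *\<^sub>v u) \<bullet> (snd D *\<^sub>v (R *\<^sub>v u)))"
    using D carriers[OF u] lam by (simp_all add: weight_def)
  with coercive[OF u] show ?thesis by (simp add: energy_def mult.assoc)
qed

text \<open>Representing the form by a matrix turns solvability of the weak equation into a
  determinant question.\<close>

lemma energy_matrix:
  obtains A where "A \<in> carrier_mat N N"
    "\<And>u v. u \<in> carrier_vec N \<Longrightarrow> v \<in> carrier_vec N \<Longrightarrow> v \<bullet> (A *\<^sub>v u) = energy D v u"
proof -
  define C where "C = transpose_mat S * S"
  \<comment> \<open>Both weighted terms have the shape \<open>B^T E B\<close>, so one computation
    serves \<open>G\<close> and \<open>R\<close>.\<close>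
  define H where "H B E = transpose_mat B * (E * B)" for B E :: "real mat"
  define A where "A = C + lam1 \<cdot>\<^sub>m H G (fst D) + lam2 \<cdot>\<^sub>m H R (snd D)"
  have DD: "fst D \<in> carrier_mat m m" "snd D \<in> carrier_mat m m"
    using D by (auto simp: weight_def)
  have H: "H B E \<in> carrier_mat N N"
    "u \<in> carrier_vec N \<Longrightarrow> v \<in> carrier_vec N \<Longrightarrow> v \<bullet> (H B E *\<^sub>v u) = (B *\<^sub>v v) \<bullet> (E *\<^sub>v (B *\<^sub>v u))"
    if B: "B \<in> carrier_mat m N" and E: "E \<in> carrier_mat m m" for B E :: "real mat" and u v
  proof -
    show "H B E \<in> carrier_mat N N" using B E by (auto simp: H_def)
    assume u: "u \<in> carrier_vec N" and v: "v \<in> carrier_vec N"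
    have EB: "E *\<^sub>v (B *\<^sub>v u) \<in> carrier_vec m" using B E u by auto
    have "H B E *\<^sub>v u = transpose_mat B *\<^sub>v (E *\<^sub>v (B *\<^sub>v u))"
      unfolding H_def using B E u
      by (simp add: assoc_mult_mat_vec[of _ N m _ N] assoc_mult_mat_vec[of _ m m _ N])
    then have "v \<bullet> (H B E *\<^sub>v u) = (transpose_mat B *\<^sub>v (E *\<^sub>v (B *\<^sub>v u))) \<bullet> v"
      using B EB v by (simp add: comm_scalar_prod[of v N])
    also have "\<dots> = (E *\<^sub>v (B *\<^sub>v u)) \<bullet> (B *\<^sub>v v)"
      using B v EB by (rule transpose_vec_mult_scalar)
    also have "\<dots> = (B *\<^sub>v v) \<bullet> (E *\<^sub>v (B *\<^sub>v u))"
      using EB B v by (intro comm_scalar_prod[of _ m]) auto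
    finally show "v \<bullet> (H B E *\<^sub>v u) = (B *\<^sub>v v) \<bullet> (E *\<^sub>v (B *\<^sub>v u))" .
  qed
  have C: "C \<in> carrier_mat N N" using S by (simp add: C_def)
  note HG = H[OF G DD(1)] and HR = H[OF R DD(2)]
  have sm: "(k \<cdot>\<^sub>m B) *\<^sub>v u = k \<cdot>\<^sub>v (B *\<^sub>v u)"
    if "B \<in> carrier_mat N N" "u \<in> carrier_vec N" for k :: real and B u
    using that by (intro eq_vecI) auto
  show ?thesis
  proof
    show "A \<in> carrier_mat N N" using C HG HR by (simp add: A_def)
    fix u v :: "real vec"
    assume u: "u \<in> carrier_vec N" and v: "v \<in> carrier_vec N"
    have "A *\<^sub>v u = C *\<^sub>v u + lam1 \<cdot>\<^sub>v (H G (fst D) *\<^sub>v u) + lam2 \<cdot>\<^sub>v (H R (snd D) *\<^sub>v u)"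
      unfolding A_def using C HG(1) HR(1) u
      by (simp add: add_mult_distrib_mat_vec[of _ N N] sm del: assoc_add_vec assoc_add_mat)
    moreover have "C *\<^sub>v u \<in> carrier_vec N" "H G (fst D) *\<^sub>v u \<in> carrier_vec N"
      "H R (snd D) *\<^sub>v u \<in> carrier_vec N"
      using C HG(1) HR(1) u by auto
    ultimately show "v \<bullet> (A *\<^sub>v u) = energy D v u"
      using v u scalar_prod_gram[OF S v u]
      by (simp add: scalar_prod_add_distrib[of _ N] HG(2) HR(2) energy_def C_def)
  qed
qed

text \<open>A kernel vector of the energy matrix has zero energy and vanishes by coercivity. Hence
  the matrix is invertible, and its inverse applied to \<open>S^T f\<close> is the solution.\<close>

lemma weak_solution_exists:
  assumes f: "f \<in> carrier_vec n"
  shows "\<exists>u. weak_solution f D u"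
proof -
  obtain A where A: "A \<in> carrier_mat N N"
    and eA: "\<And>u v. u \<in> carrier_vec N \<Longrightarrow> v \<in> carrier_vec N \<Longrightarrow> v \<bullet> (A *\<^sub>v u) = energy D v u"
    using energy_matrix by blast
  have "det A \<noteq> 0"
  proof
    assume "det A = 0"
    then obtain v where v: "v \<in> carrier_vec N" "v \<noteq> 0\<^sub>v N" "A *\<^sub>v v = 0\<^sub>v N"
      using det_0_iff_vec_prod_zero[OF A] by blast
    have "energy D v v = 0" using eA[OF v(1) v(1)] v by simp
    then have "a * (v \<bullet> v) \<le> 0" using energy_coercive[OF v(1)] by simp
    then have "v \<bullet> v = 0"
      using a scalar_prod_self_nonneg[of v] by (simp add: mult_le_0_iff)
    with v(1,2) scalar_prod_self_eq_0_iff show False by blast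
  qed
  from det_non_zero_imp_unit[OF A this, of "()"]
  obtain C where C: "C \<in> carrier_mat N N" "A * C = 1\<^sub>m N"
    by (auto simp: Units_def ring_mat_def)
  define b where "b = transpose_mat S *\<^sub>v f"
  have b: "b \<in> carrier_vec N" using S f by (simp add: b_def)
  define u where "u = C *\<^sub>v b"
  have u: "u \<in> carrier_vec N" using C b by (simp add: u_def)
  have Au: "A *\<^sub>v u = b"
    unfolding u_def using assoc_mult_mat_vec[OF A C(1) b] C(2) b by simp
  have "energy D u v = f \<bullet> (S *\<^sub>v v)" if v: "v \<in> carrier_vec N" for v
  proof -
    have "energy D u v = v \<bullet> b"
      using energy_commute[OF u v] eA[OF u v] Au by simp
    also have "\<dots> = b \<bullet> v" using v b by (rule comm_scalar_prod)
    also have "\<dots> = f \<bullet> (S *\<^sub>v v)"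
      unfolding b_def using S v f by (rule transpose_vec_mult_scalar)
    finally show ?thesis .
  qed
  with u show ?thesis by (auto simp: weak_solution_def)
qed

lemma cost_expand:
  assumes f: "f \<in> carrier_vec n" and u: "u \<in> carrier_vec N"
  shows "cost f D u = 1 / 2 * energy D u u - f \<bullet> (S *\<^sub>v u) + 1 / 2 * (f \<bullet> f)"
proof -
  note Su = carriers(1)[OF u]
  have "(l2_norm (S *\<^sub>v u - f))\<^sup>2 = (S *\<^sub>v u) \<bullet> (S *\<^sub>v u) - 2 * (f \<bullet> (S *\<^sub>v u)) + f \<bullet> f"
    using f Su comm_scalar_prod[OF f Su]
    by (simp add: l2_norm_power2 minus_scalar_prod_distrib[of _ n] scalar_prod_minus_distrib[of _ n])
  then show ?thesis by (simp add: cost_def energy_def algebra_simps)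
qed

text \<open>Completing the square: the weak equation cancels the terms linear in
  \<open>v - u\<close>.\<close>

lemma cost_weak_solution:
  assumes f: "f \<in> carrier_vec n" and u: "weak_solution f D u" and v: "v \<in> carrier_vec N"
  shows "cost f D v = cost f D u + 1 / 2 * energy D (v - u) (v - u)"
proof -
  have uN: "u \<in> carrier_vec N" using u by (simp add: weak_solution_def)
  have d: "v - u \<in> carrier_vec N" using uN v by simp
  have "energy D (v - u) (v - u) = energy D v (v - u) - energy D u (v - u)"
    by (rule energy_diff[OF v uN d])
  also have "\<dots> = (energy D v v - energy D u v) - (energy D v u - energy D u u)"
    using energy_commute[OF v d] energy_commute[OF uN d] energy_diff[OF v uN v]
      energy_diff[OF v uN uN] by simp
  also have "\<dots> = energy D v v - 2 * energy D u v + energy D u u"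
    using energy_commute[OF v uN] by simp
  finally show ?thesis
    using cost_expand[OF f v] cost_expand[OF f uN] u v uN
    by (simp add: weak_solution_def algebra_simps)
qed

text \<open>The cost exceeds its value at \<open>u\<close> by at least \<open>a / 2\<close> times
  the squared distance to \<open>u\<close>. This gives minimality and uniqueness together, so the
  description operator in \<open>T_map\<close> has a unique witness.\<close>

lemma minimizer_iff_weak_solution:
  assumes f: "f \<in> carrier_vec n" and u: "weak_solution f D u"
  shows "is_arg_min (cost f D) (\<lambda>u. u \<in> carrier_vec N) v \<longleftrightarrow> v = u"
proof
  have uN: "u \<in> carrier_vec N" using u by (simp add: weak_solution_def)
  have le: "cost f D u + a / 2 * ((z - u) \<bullet> (z - u)) \<le> cost f D z" if "z \<in> carrier_vec N" for z
    using cost_weak_solution[OF f u that] energy_coercive[of "z - u"] that uN by simp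
  show "is_arg_min (cost f D) (\<lambda>u. u \<in> carrier_vec N) v" if "v = u"
  proof -
    have "cost f D u \<le> cost f D z" if "z \<in> carrier_vec N" for z
      using le[OF that] a scalar_prod_self_nonneg[of "z - u"]
        mult_nonneg_nonneg[of "a / 2" "(z - u) \<bullet> (z - u)"] by linarith
    with uN \<open>v = u\<close> show ?thesis by (auto simp: is_arg_min_def not_less)
  qed
  assume "is_arg_min (cost f D) (\<lambda>u. u \<in> carrier_vec N) v"
  then have v: "v \<in> carrier_vec N" and "cost f D v \<le> cost f D u"
    using uN by (auto simp: is_arg_min_def not_less)
  with le[OF v] have "a / 2 * ((v - u) \<bullet> (v - u)) \<le> 0" by simp
  then have "(v - u) \<bullet> (v - u) = 0"
    using a scalar_prod_self_nonneg[of "v - u"] by (simp add: mult_le_0_iff)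
  then have "v - u = 0\<^sub>v N"
    using scalar_prod_self_eq_0_iff[of "v - u" N] v uN by simp
  then have "v $ i - u $ i = 0" if "i < N" for i
    using that v uN by (metis carrier_vecD index_minus_vec(1) index_zero_vec(1))
  then show "v = u" using v uN by (intro eq_vecI) auto
qed

lemma weak_solution_bound:
  assumes f: "f \<in> carrier_vec n" and u: "weak_solution f D u"
  shows "l2_norm u \<le> spectral_norm S * l2_norm f / a"
\<comment> \<open>The estimate is divided by \<open>l2_norm u\<close>, so norm zero is treated
  apart.\<close>
proof (cases "l2_norm u = 0")
  case True
  then show ?thesis using a spectral_norm_nonneg[OF S] by simp
next
  case False
  then have pos: "0 < l2_norm u" by (simp add: order_less_le)
  have uN: "u \<in> carrier_vec N" using u by (simp add: weak_solution_def)
  have "a * l2_norm u * l2_norm u = a * (u \<bullet> u)"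
    using l2_norm_power2[of u] by (simp add: power2_eq_square)
  also have "\<dots> \<le> f \<bullet> (S *\<^sub>v u)"
    using energy_coercive[OF uN] u uN by (simp add: weak_solution_def)
  also have "\<dots> \<le> l2_norm f * l2_norm (S *\<^sub>v u)"
    using Cauchy_Schwarz_l2_norm[OF f carriers(1)[OF uN]] by simp
  also have "\<dots> \<le> l2_norm f * (spectral_norm S * l2_norm u)"
    using l2_norm_mult_mat_vec_le[OF S uN] by (intro mult_left_mono) auto
  finally have "a * l2_norm u \<le> l2_norm f * spectral_norm S"
    using pos by simp
  then show ?thesis using a by (simp add: field_simps)
qed

end

text \<open>Both solutions satisfy weak equations with the same right-hand side, so the energy of
  \<open>u - v\<close> reduces to the difference of two energies at \<open>v\<close>, in which the
  \<open>S\<close> terms cancel. One factor \<open>1 / a\<close> comes from coercivity, the other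
  from the bound on \<open>v\<close>.\<close>

lemma weak_solution_perturbation:
  assumes f: "f \<in> carrier_vec n"
    and D: "weight (fst D)" "weight (snd D)" and E: "weight (fst E)" "weight (snd E)"
    and u: "weak_solution f D u" and v: "weak_solution f E v"
    and \<delta>: "0 \<le> \<delta>"
      "\<And>x y. x \<in> carrier_vec m \<Longrightarrow> y \<in> carrier_vec m \<Longrightarrow>
         x \<bullet> (fst E *\<^sub>v y) - x \<bullet> (fst D *\<^sub>v y) \<le> \<delta> * l2_norm x * l2_norm y"
      "\<And>x y. x \<in> carrier_vec m \<Longrightarrow> y \<in> carrier_vec m \<Longrightarrow>
         x \<bullet> (snd E *\<^sub>v y) - x \<bullet> (snd D *\<^sub>v y) \<le> \<delta> * l2_norm x * l2_norm y"
  shows "l2_norm (u - v) \<le> (lam1 * (spectral_norm G)\<^sup>2 + lam2 * (spectral_norm R)\<^sup>2) * \<delta>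
    * spectral_norm S * l2_norm f / a\<^sup>2"
    (is "_ \<le> ?K * \<delta> * ?s * _ / _")
proof (cases "l2_norm (u - v) = 0")
  case True
  then show ?thesis using \<delta>(1) lam spectral_norm_nonneg[OF S] by simp
next
  case False
  define d where "d = u - v"
  from False have pos: "0 < l2_norm d" by (simp add: order_less_le d_def)
  have uN: "u \<in> carrier_vec N" and vN: "v \<in> carrier_vec N"
    using u v by (auto simp: weak_solution_def)
  then have d: "d \<in> carrier_vec N" by (simp add: d_def)
  have part: "(B *\<^sub>v v) \<bullet> (C' *\<^sub>v (B *\<^sub>v d)) - (B *\<^sub>v v) \<bullet> (C *\<^sub>v (B *\<^sub>v d))
      \<le> \<delta> * (spectral_norm B)\<^sup>2 * l2_norm v * l2_norm d"
    if B: "B \<in> carrier_mat m N"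
      and C: "\<And>x y. x \<in> carrier_vec m \<Longrightarrow> y \<in> carrier_vec m \<Longrightarrow>
         x \<bullet> (C' *\<^sub>v y) - x \<bullet> (C *\<^sub>v y) \<le> \<delta> * l2_norm x * l2_norm y" for B C C'
  proof -
    have "(B *\<^sub>v v) \<bullet> (C' *\<^sub>v (B *\<^sub>v d)) - (B *\<^sub>v v) \<bullet> (C *\<^sub>v (B *\<^sub>v d))
        \<le> \<delta> * (l2_norm (B *\<^sub>v v) * l2_norm (B *\<^sub>v d))"
      using C[of "B *\<^sub>v v" "B *\<^sub>v d"] B vN d by (simp add: mult.assoc)
    also have "\<dots> \<le> \<delta> * ((spectral_norm B * l2_norm v) * (spectral_norm B * l2_norm d))"
      using l2_norm_mult_mat_vec_le[OF B vN] l2_norm_mult_mat_vec_le[OF B d] \<delta>(1)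
        spectral_norm_nonneg[OF B]
      by (intro mult_left_mono mult_mono) auto
    finally show ?thesis by (simp add: power2_eq_square mult_ac)
  qed
  have "a * l2_norm d * l2_norm d = a * (d \<bullet> d)"
    using l2_norm_power2[of d] by (simp add: power2_eq_square)
  also have "\<dots> \<le> energy D d d" by (rule energy_coercive[OF D d])
  also have "\<dots> = energy D u d - energy D v d"
    using energy_diff[OF D uN vN d] by (simp add: d_def)
  \<comment> \<open>Here \<open>energy D u d\<close> and \<open>energy E v d\<close> both equal
    \<open>f \<bullet> (S *\<^sub>v d)\<close>.\<close>
  also have "\<dots> = energy E v d - energy D v d"
    using u v d by (simp add: weak_solution_def)
  also have "\<dots> = lam1 * ((G *\<^sub>v v) \<bullet> (fst E *\<^sub>v (G *\<^sub>v d)) - (G *\<^sub>v v) \<bullet> (fst D *\<^sub>v (G *\<^sub>v d)))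
      + lam2 * ((R *\<^sub>v v) \<bullet> (snd E *\<^sub>v (R *\<^sub>v d)) - (R *\<^sub>v v) \<bullet> (snd D *\<^sub>v (R *\<^sub>v d)))"
    by (simp add: energy_def algebra_simps)
  also have "\<dots> \<le> lam1 * (\<delta> * (spectral_norm G)\<^sup>2 * l2_norm v * l2_norm d)
      + lam2 * (\<delta> * (spectral_norm R)\<^sup>2 * l2_norm v * l2_norm d)"
    using part[OF G \<delta>(2)] part[OF R \<delta>(3)] lam by (intro add_mono mult_left_mono) auto
  also have "\<dots> = ?K * \<delta> * l2_norm v * l2_norm d" by (simp add: algebra_simps)
  finally have "a * l2_norm d \<le> ?K * \<delta> * l2_norm v" using pos by simp
  also have "\<dots> \<le> ?K * \<delta> * (?s * l2_norm f / a)"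
    using weak_solution_bound[OF E f v] \<delta>(1) lam
    by (intro mult_left_mono) auto
  finally have "l2_norm d \<le> ?K * \<delta> * (?s * l2_norm f / a) / a"
    using a by (simp only: pos_le_divide_eq mult.commute)
  then show ?thesis by (simp add: d_def power2_eq_square mult.assoc)
qed

end

section \<open>The Lipschitz estimate for the solution map\<close>

theorem theorem6p3:
  fixes h w n :: nat
    and lam1 lam2 omin omax r L_W :: real
    and f :: "real vec"
    and W :: "real vec \<Rightarrow> real mat \<times> real mat"
  assumes "2 \<le> h" and "2 \<le> w" and "n = h * w"
    and "f \<in> carrier_vec n"
    and "0 < lam1" and "0 < lam2"
    and "0 < omin" and "omin \<le> omax" and "omax < 1"
    and "0 < r"
    and "\<And>x. x \<in> carrier_vec (3 * n) \<Longrightarrow>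
           admissible_weight (2 * n) omin omax (fst (W x))
           \<and> admissible_weight (2 * n) omin omax (snd (W x))"
    and "\<And>x y. x \<in> l2_ball (3 * n) r \<Longrightarrow> y \<in> l2_ball (3 * n) r \<Longrightarrow>
           weight_norm (W x - W y) \<le> L_W * l2_norm (x - y)"
  shows "\<exists>L_T.
           (\<forall>x \<in> l2_ball (3 * n) r. \<forall>y \<in> l2_ball (3 * n) r.
              l2_norm (T_map h w lam1 lam2 f W x - T_map h w lam1 lam2 f W y)
                \<le> L_T * l2_norm (x - y))
           \<and> L_T \<le> ((lam1 * (spectral_norm (G_mat h w))\<^sup>2 + lam2 * (spectral_norm (R_mat h w))\<^sup>2)
                      * L_W * spectral_norm (S_mat h w) * l2_norm f)
                    / (alpha h w lam1 lam2 omin)\<^sup>2"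
proof -
  have hw: "0 < h * w" using assms(1,2) by simp
  let ?\<alpha> = "alpha h w lam1 lam2 omin"
  \<comment> \<open>The coercivity constant is \<open>alpha\<close> itself, by the estimate for the
    smallest singular value of \<open>M_mat\<close>.\<close>
  interpret coercive_least_squares "S_mat h w" "G_mat h w" "R_mat h w"
    n "2 * n" "3 * n" lam1 lam2 omin ?\<alpha>
    using dims(3-5)[of h w] assms(3,5-7) alpha_pos[OF hw, of lam1 lam2 omin]
      alpha_coercive[OF hw, of lam1 lam2 omin]
    by unfold_locales auto
  let ?T = "T_map h w lam1 lam2 f W"
  let ?K = "lam1 * (spectral_norm (G_mat h w))\<^sup>2 + lam2 * (spectral_norm (R_mat h w))\<^sup>2"
  \<comment> \<open>The witness for \<open>L_T\<close> is the asserted bound itself, so its upper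
    estimate holds with equality.\<close>
  let ?L = "?K * L_W * spectral_norm (S_mat h w) * l2_norm f / ?\<alpha>\<^sup>2"
  have adm: "admissible_weight (2 * n) omin omax (fst (W x))"
    "admissible_weight (2 * n) omin omax (snd (W x))" if "x \<in> carrier_vec (3 * n)" for x
    using assms(11)[OF that] by auto
  have diag: "fst (W x) \<in> carrier_mat (2 * n) (2 * n)" "diagonal_mat (fst (W x))"
    "snd (W x) \<in> carrier_mat (2 * n) (2 * n)" "diagonal_mat (snd (W x))"
    if "x \<in> carrier_vec (3 * n)" for x
    using adm[OF that] by (auto simp: admissible_weight_def)
  have wt: "weight (fst (W x))" "weight (snd (W x))" if "x \<in> carrier_vec (3 * n)" for x
    using diag[OF that] adm[OF that] admissible_weight_lower diagonal_mat_symmetric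
    by (auto simp: weight_def)
  have sol: "weak_solution f (W x) (?T x)" if x: "x \<in> carrier_vec (3 * n)" for x
  proof -
    obtain u where u: "weak_solution f (W x) u"
      using weak_solution_exists[OF wt[OF x] assms(4)] by blast
    \<comment> \<open>Identifying the two functionals transfers uniqueness of the minimizer to the
      description in \<open>T_map\<close>.\<close>
    have "objective h w lam1 lam2 f (W x) = cost f (W x)"
      by (intro ext) (simp add: objective_def cost_def)
    then have "?T x = u"
      using minimizer_iff_weak_solution[OF wt[OF x] assms(4) u] assms(3)
      by (simp add: T_map_def)
    with u show ?thesis by simp
  qed
  have "l2_norm (?T x - ?T y) \<le> ?L * l2_norm (x - y)"
    if x: "x \<in> l2_ball (3 * n) r" and y: "y \<in> l2_ball (3 * n) r" for x y
  proof -
    have xc: "x \<in> carrier_vec (3 * n)" and yc: "y \<in> carrier_vec (3 * n)"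
      using x y by (auto simp: l2_ball_def)
    let ?\<delta> = "L_W * l2_norm (x - y)"
    \<comment> \<open>Pairs are subtracted componentwise, so the weight norm of the difference
      controls the diagonal entries of both components.\<close>
    have Wd: "W x - W y = (fst (W x) - fst (W y), snd (W x) - snd (W y))"
      by (simp add: prod_eq_iff)
    have entry: "\<bar>fst (W y) $$ (i, i) - fst (W x) $$ (i, i)\<bar> \<le> ?\<delta>"
      "\<bar>snd (W y) $$ (i, i) - snd (W x) $$ (i, i)\<bar> \<le> ?\<delta>" if i: "i < 2 * n" for i
    proof -
      have c: "fst (W x) - fst (W y) \<in> carrier_mat (2 * n) (2 * n)"
        "snd (W x) - snd (W y) \<in> carrier_mat (2 * n) (2 * n)"
        using diag[OF xc] diag[OF yc] by auto
      show "\<bar>fst (W y) $$ (i, i) - fst (W x) $$ (i, i)\<bar> \<le> ?\<delta>"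
        "\<bar>snd (W y) $$ (i, i) - snd (W x) $$ (i, i)\<bar> \<le> ?\<delta>"
        using weight_norm_fst[OF c i] weight_norm_snd[OF c i] assms(12)[OF x y] Wd
          diag[OF xc] diag[OF yc] i
        by (auto simp: abs_minus_commute)
    qed
    \<comment> \<open>\<open>L_W\<close> comes without a sign; the product is nonnegative because it
      dominates the absolute value at diagonal index 0.\<close>
    have "0 < 2 * n" using hw assms(3) by simp
    from entry(1)[OF this] have \<delta>: "0 \<le> ?\<delta>" by linarith
    \<comment> \<open>The perturbation estimate is used with \<open>D = W x\<close> and
      \<open>E = W y\<close>, so the norm bound falls on the solution at \<open>y\<close>.\<close>
    have "l2_norm (?T x - ?T y)
        \<le> ?K * ?\<delta> * spectral_norm (S_mat h w) * l2_norm f / ?\<alpha>\<^sup>2"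
      using diag[OF xc] diag[OF yc] entry \<delta>
      by (intro weak_solution_perturbation[OF assms(4) wt[OF xc] wt[OF yc] sol[OF xc] sol[OF yc]]
          diagonal_scalar_prod_diff_le) auto
    then show ?thesis by (simp add: mult_ac)
  qed
  then show ?thesis by blast
qed

end
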